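(* For each integer $n\ge 2$ there exists a constant $C>0$, depending only on $n$, such that for all integers $k\ge 0$, $$c(n,k)\ \ge\ C\,k^{\frac{n-1}{n+1}}.$$
   Context: For integers $n\ge1$, $k\ge0$, $c(n,k)$ denotes the least integer such that for every $m$, every matrix $A\in\mathbb{R}^{m\times n}$ and every $b\in\mathbb{R}^m$: if the polyhedron $\{x\in\mathbb{R}^n : Ax\le b\}$ contains exactly $k$ integer points (points of $\mathbb{Z}^n$), then there is a subset $I$ of the rows of $A$ with $|I|\le c(n,k)$ such that $\{x\in\mathbb{R}^n : A_Ix\le b_I\}$ contains exactly the same $k$ integer points, where $A_I,b_I$ are the restrictions to the rows in $I$. *)

theory Defs
  imports Complex_Main "Jordan_Normal_Form.Matrix" "Jordan_Normal_Form.DL_Submatrix"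
begin

definition subvec :: "'a vec \<Rightarrow> nat set \<Rightarrow> 'a vec" where
  "subvec b I = vec (card {i. i < dim_vec b \<and> i \<in> I}) (\<lambda>i. b $ pick I i)"

definition polyhedron_of :: "real mat \<Rightarrow> real vec \<Rightarrow> real vec set" where
  "polyhedron_of A b = {x \<in> carrier_vec (dim_col A). A *\<^sub>v x \<le> b}"

definition int_points :: "real vec set \<Rightarrow> real vec set" where
  "int_points P = {x \<in> P. \<forall>i < dim_vec x. x $ i \<in> \<int>}"

text \<open>Finiteness is required explicitly, as \<^const>\<open>card\<close> of an infinite set is 0.\<close>

definition row_bound :: "nat \<Rightarrow> nat \<Rightarrow> nat \<Rightarrow> bool" where
  "row_bound n k N \<longleftrightarrow>
     (\<forall>m. \<forall>A \<in> carrier_mat m n. \<forall>b \<in> carrier_vec m.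
        finite (int_points (polyhedron_of A b)) \<and> card (int_points (polyhedron_of A b)) = k \<longrightarrow>
        (\<exists>I \<subseteq> {..<m}. card I \<le> N \<and>
           int_points (polyhedron_of (submatrix A I UNIV) (subvec b I)) =
           int_points (polyhedron_of A b)))"

text \<open>For \<open>n \<ge> 1\<close> some bound exists: by the usual parity argument, \<open>2 ^ n * (k + 1)\<close> is one.
  No negative integer is a bound, since every \<open>k\<close> is attained by some polyhedron, so the least
  integer may be taken in \<^typ>\<open>nat\<close>.\<close>

definition c :: "nat \<Rightarrow> nat \<Rightarrow> nat" where
  "c n k = (LEAST N. row_bound n k N)"

end

theory Submission
  imports Defs "HOL-Library.FuncSet" "HOL-Library.Infinite_Set"
begin

text \<open>
  Why the bound holds. Write \<open>n = d + 1\<close>, split a point of \<open>\<real>\<^sup>n\<close> into its first \<open>d\<close> coordinates \<open>x\<close>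
  and its last one \<open>y\<close>, and consider the integer points with \<open>x \<in> {0..R}\<^sup>d\<close> strictly above the
  paraboloid \<open>y = |x|\<^sup>2\<close>. For \<open>u \<in> {0..R}\<^sup>d\<close> the inequality \<open>y - 2 u \<bullet> x + |u|\<^sup>2 \<ge> 1\<close> bounds a half-space
  parallel to the tangent plane at \<open>(u, |u|\<^sup>2)\<close>. At \<open>(x, |x|\<^sup>2)\<close> its left-hand side is \<open>|x - u|\<^sup>2\<close>,
  so among the grid points on the paraboloid it excludes only \<open>(u, |u|\<^sup>2)\<close>; it excludes no integer
  point strictly above the paraboloid. Together with the box
  inequalities, these \<open>(R + 1)\<^sup>d\<close> half-spaces leave exactly the integer points strictly above the
  paraboloid, and dropping the inequality of \<open>u\<close> lets \<open>(u, |u|\<^sup>2)\<close> in. Hence none of them can be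
  spared.

  To be left with exactly \<open>k\<close> points, one more inequality cuts the set from above. Its linear form
  reads \<open>(x, y)\<close> as a number with digits \<open>x\<close> in base \<open>R + 1\<close> and leading part \<open>y\<close>. This takes
  different values at different points, so moving the cut adds the points one at a time, and every
  \<open>k\<close> occurs (\<open>card_int_sols_system\<close>). If \<open>k > d R (R + 1)\<^sup>d\<^sup>+\<^sup>1\<close>, then the cut is so high that it
  spares all the points \<open>(u, |u|\<^sup>2)\<close>, and each tangent inequality stays indispensable
  (\<open>tang_row_critical\<close>). So every admissible bound is at least \<open>(R + 1)\<^sup>d\<close> (\<open>row_bound_ge\<close>); taking
  \<open>R\<close> of the order of \<open>k\<close> to the power \<open>1 / (d + 2)\<close> gives \<open>k\<close> to the power
  \<open>d / (d + 2) = (n - 1) / (n + 1)\<close>.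

  The value \<open>c n k\<close> is a least element, and it satisfies the property that defines it only because
  some bound exists (\<open>row_bound_exists\<close>). That is the quantitative theorem of Doignon, Bell and
  Scarf, in the weak form \<open>2\<^sup>n (k + 1)\<close>. In a smallest equivalent subsystem every inequality has an
  integer point that only it excludes; after relaxing the right-hand sides as far as possible, the
  midpoint of two such points of equal parity is integral and must be one of the \<open>k\<close> solutions, so a
  parity class contains at most \<open>k + 1\<close> of them.
\<close>

section \<open>Integer solutions of finite systems of inequalities\<close>

text \<open>
  A pair \<open>(a, \<beta>)\<close> stands for the inequality \<open>a \<bullet> x \<le> \<beta>\<close>. Sets of such pairs make subsystems into
  subsets, free of the reindexing that a submatrix brings. The empty system describes \<open>\<int>\<^sup>n\<close>.
\<close>

definition int_sols :: "nat \<Rightarrow> (real vec \<times> real) set \<Rightarrow> real vec set" where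
  "int_sols n F = {x \<in> carrier_vec n. (\<forall>i<n. x $ i \<in> \<int>) \<and> (\<forall>q\<in>F. fst q \<bullet> x \<le> snd q)}"

lemma int_sols_antimono: "F \<subseteq> G \<Longrightarrow> int_sols n G \<subseteq> int_sols n F"
  by (auto simp: int_sols_def)

lemma pick_image:
  assumes "I \<subseteq> {..<m}"
  shows "pick I ` {..<card I} = I"
proof
  have fin: "finite I" by (rule finite_subset[OF assms]) simp
  show "pick I ` {..<card I} \<subseteq> I" using pick_in_set_le by auto
  show "I \<subseteq> pick I ` {..<card I}"
  proof
    fix i assume i: "i \<in> I"
    have "card {a\<in>I. a < i} < card I"
      by (rule psubset_card_mono[OF fin]) (use i in blast)
    then show "i \<in> pick I ` {..<card I}"
      by (intro image_eqI[of i "pick I" "card {a\<in>I. a < i}"]) (simp_all add: pick_card_in_set[OF i])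
  qed
qed

lemma int_points_polyhedron_of:
  assumes A: "A \<in> carrier_mat m n" and b: "b \<in> carrier_vec m"
  shows "int_points (polyhedron_of A b) = int_sols n ((\<lambda>i. (row A i, b $ i)) ` {..<m})"
proof -
  have [simp]: "dim_row A = m" "dim_col A = n" "dim_vec b = m" by (simp_all add: carrier_matD[OF A] carrier_vecD[OF b])
  show ?thesis
    unfolding int_points_def polyhedron_of_def int_sols_def less_eq_vec_def by auto
qed

lemma int_points_subsystem:
  assumes A: "A \<in> carrier_mat m n" and b: "b \<in> carrier_vec m" and I: "I \<subseteq> {..<m}"
  shows "int_points (polyhedron_of (submatrix A I UNIV) (subvec b I))
       = int_sols n ((\<lambda>i. (row A i, b $ i)) ` I)"
proof -
  have eqI: "{i. i < m \<and> i \<in> I} = I" using I by auto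
  have fin: "finite I" by (rule finite_subset[OF I]) simp
  have carr: "submatrix A I UNIV \<in> carrier_mat (card I) n" "subvec b I \<in> carrier_vec (card I)"
  proof -
    have [simp]: "dim_row A = m" "dim_col A = n" "dim_vec b = m" by (simp_all add: carrier_matD[OF A] carrier_vecD[OF b])
    show "submatrix A I UNIV \<in> carrier_mat (card I) n"
      by (rule carrier_matI) (simp_all add: dim_submatrix eqI)
    show "subvec b I \<in> carrier_vec (card I)"
      by (rule carrier_vecI) (simp add: subvec_def eqI)
  qed
  have pk: "pick I i < m" if "i < card I" for i
    using pick_in_set_le[OF that] I by auto
  have rows: "row (submatrix A I UNIV) i = row A (pick I i)" if "i < card I" for i
    using that A pk[OF that] carr
    by (intro eq_vecI) (simp_all add: submatrix_def pick_UNIV eqI)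
  have ents: "subvec b I $ i = b $ pick I i" if "i < card I" for i
    using that b by (simp add: subvec_def eqI)
  have "(\<lambda>i. (row (submatrix A I UNIV) i, subvec b I $ i)) ` {..<card I}
      = (\<lambda>i. (row A (pick I i), b $ (pick I i))) ` {..<card I}"
    by (intro image_cong refl) (simp add: rows ents)
  also have "\<dots> = (\<lambda>i. (row A i, b $ i)) ` (pick I ` {..<card I})"
    by (simp add: image_image)
  finally show ?thesis
    using int_points_polyhedron_of[OF carr] pick_image[OF I] by simp
qed

text \<open>
  Repeated rows are the only difference between a matrix and a set of inequalities. Choosing one row
  for each inequality of a subset keeps the number of rows equal to the size of the subset.
\<close>

lemma row_bound_iff:
  "row_bound n k N \<longleftrightarrow>
     (\<forall>F. finite F \<and> fst ` F \<subseteq> carrier_vec n \<and> finite (int_sols n F) \<and> card (int_sols n F) = k \<longrightarrow>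
        (\<exists>G\<subseteq>F. card G \<le> N \<and> int_sols n G = int_sols n F))"
  (is "?L \<longleftrightarrow> ?R")
proof
  assume L: ?L
  show ?R
  proof (intro allI impI, elim conjE)
    fix F assume F: "finite F" "fst ` F \<subseteq> carrier_vec n" "finite (int_sols n F)" "card (int_sols n F) = k"
    obtain L where L': "set L = F" using finite_list[OF F(1)] by blast
    define A where "A = mat_of_rows n (map fst L)"
    define b where "b = vec_of_list (map snd L)"
    define g where "g = (\<lambda>i. (row A i, b $ i))"
    have A: "A \<in> carrier_mat (length L) n" and b: "b \<in> carrier_vec (length L)"
      by (auto simp: A_def b_def intro!: carrier_vecI)
    have gi: "g i = L ! i" if "i < length L" for i
    proof -
      have "fst (L ! i) \<in> carrier_vec n" using F(2) L' nth_mem[OF that] by blast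
      then show ?thesis using that
        by (simp add: g_def A_def b_def vec_of_list_index del: vec_of_list_map)
    qed
    have F_eq: "F = g ` {..<length L}"
    proof -
      have "F = (!) L ` {..<length L}" unfolding L'[symmetric] set_conv_nth by auto
      also have "\<dots> = g ` {..<length L}" by (intro image_cong) (simp_all add: gi)
      finally show ?thesis .
    qed
    have eq: "int_points (polyhedron_of A b) = int_sols n F"
      using int_points_polyhedron_of[OF A b] F_eq g_def by simp
    obtain I where I: "I \<subseteq> {..<length L}" "card I \<le> N"
      "int_points (polyhedron_of (submatrix A I UNIV) (subvec b I)) = int_sols n F"
      using L[unfolded row_bound_def, rule_format, OF A b] F(3,4) unfolding eq by blast
    have "int_sols n (g ` I) = int_sols n F"
      using int_points_subsystem[OF A b I(1)] I(3) g_def by simp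
    moreover have "g ` I \<subseteq> F" using I(1) F_eq by auto
    moreover have "card (g ` I) \<le> N"
      using I(2) card_image_le[OF finite_subset[OF I(1)], of g] by simp
    ultimately show "\<exists>G\<subseteq>F. card G \<le> N \<and> int_sols n G = int_sols n F" by blast
  qed
next
  assume R: ?R
  show ?L unfolding row_bound_def
  proof (intro allI ballI impI, elim conjE)
    fix m and A :: "real mat" and b :: "real vec"
    assume A: "A \<in> carrier_mat m n" and b: "b \<in> carrier_vec m"
      and fin: "finite (int_points (polyhedron_of A b))"
      and crd: "card (int_points (polyhedron_of A b)) = k"
    define g where "g = (\<lambda>i. (row A i, b $ i))"
    have eq: "int_points (polyhedron_of A b) = int_sols n (g ` {..<m})"
      using int_points_polyhedron_of[OF A b] g_def by simp
    have "fst ` g ` {..<m} \<subseteq> carrier_vec n" using A by (auto simp: g_def)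
    then obtain G where G: "G \<subseteq> g ` {..<m}" "card G \<le> N" "int_sols n G = int_sols n (g ` {..<m})"
      using R[rule_format, of "g ` {..<m}"] fin crd unfolding eq by blast
    obtain I where I: "I \<subseteq> {..<m}" "inj_on g I" "G = g ` I"
      using G(1) unfolding subset_image_inj by blast
    have "card I \<le> N" using G(2) I by (simp add: card_image)
    moreover have "int_points (polyhedron_of (submatrix A I UNIV) (subvec b I)) = int_sols n G"
      using int_points_subsystem[OF A b I(1)] I(3) g_def by simp
    ultimately show "\<exists>I\<subseteq>{..<m}. card I \<le> N \<and>
        int_points (polyhedron_of (submatrix A I UNIV) (subvec b I)) =
        int_points (polyhedron_of A b)"
      using I(1) G(3) eq by auto
  qed
qed

section \<open>Existence of a bound\<close>

text \<open>
  Start from a system \<open>f j z \<le> b j\<close> in which dropping any single inequality admits a point of \<open>Z\<close>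
  outside \<open>S\<close>. Relax it to \<open>f j z < \<gamma> j\<close> with \<open>b j < \<gamma> j\<close> and \<open>\<Sum>\<gamma>\<close> maximal, subject to the system
  still admitting only points of \<open>S\<close>. By maximality \<open>\<gamma> i\<close> cannot be raised further, which yields a point \<open>w i\<close> on the
  boundary \<open>f i = \<gamma> i\<close> and strictly inside all the other constraints. The strict inequalities are
  what makes midpoints of witnesses satisfy the relaxed system.
\<close>

lemma tight_witnesses:
  fixes f :: "'i \<Rightarrow> 'x \<Rightarrow> real"
  assumes finI: "finite I" and finZ: "finite Z"
    and crit: "\<And>i. i \<in> I \<Longrightarrow> \<exists>z\<in>Z - S. \<forall>j\<in>I - {i}. f j z \<le> b j"
    and sol: "\<And>z. z \<in> Z \<Longrightarrow> (\<forall>j\<in>I. f j z \<le> b j) \<Longrightarrow> z \<in> S"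
  obtains w where "\<And>i. i \<in> I \<Longrightarrow> w i \<in> Z - S"
    and "\<And>i j. i \<in> I \<Longrightarrow> j \<in> I \<Longrightarrow> i \<noteq> j \<Longrightarrow> f j (w i) < f j (w j)"
    and "\<And>z. z \<in> Z \<Longrightarrow> (\<forall>j\<in>I. f j z < f j (w j)) \<Longrightarrow> z \<in> S"
proof -
  define valid where "valid \<gamma> \<longleftrightarrow> (\<forall>i\<in>I. b i < \<gamma> i) \<and>
    (\<forall>z\<in>Z. (\<forall>i\<in>I. f i z < \<gamma> i) \<longrightarrow> z \<in> S)" for \<gamma>
  define \<Gamma> where "\<Gamma> = {\<gamma> \<in> I \<rightarrow>\<^sub>E (\<Union>i\<in>I. f i ` Z). valid \<gamma>}"
  have fin\<Gamma>: "finite \<Gamma>"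
    unfolding \<Gamma>_def by (rule finite_subset[OF _ finite_PiE[OF finI, of "\<lambda>_. \<Union>i\<in>I. f i ` Z"]])
      (use finI finZ in \<open>blast intro: finite_imageI\<close>)+
  \<comment> \<open>On \<open>Z\<close>, the inequality \<open>f i z < \<gamma>0 i\<close> says the same as \<open>f i z \<le> b i\<close>, so \<open>\<gamma>0\<close> is a
    valid starting point.\<close>
  define \<gamma>0 where "\<gamma>0 = (\<lambda>i\<in>I. Min {v \<in> f i ` Z. b i < v})"
  have \<gamma>0: "\<gamma>0 i \<in> {v \<in> f i ` Z. b i < v}" if i: "i \<in> I" for i
  proof -
    obtain z where z: "z \<in> Z - S" "\<forall>j\<in>I - {i}. f j z \<le> b j" using crit[OF i] by blast
    have "b i < f i z"
    proof (rule ccontr)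
      assume "\<not> ?thesis"
      then have "\<forall>j\<in>I. f j z \<le> b j" using z(2) by force
      then show False using sol[of z] z(1) by blast
    qed
    then have "{v \<in> f i ` Z. b i < v} \<noteq> {}" using z by auto
    then show ?thesis using Min_in[of "{v \<in> f i ` Z. b i < v}"] finZ i
      unfolding \<gamma>0_def by simp
  qed
  have "valid \<gamma>0"
    unfolding valid_def
  proof (intro conjI ballI impI)
    fix z assume z: "z \<in> Z" and lt: "\<forall>i\<in>I. f i z < \<gamma>0 i"
    have "f i z \<le> b i" if i: "i \<in> I" for i
    proof (rule ccontr)
      assume "\<not> ?thesis"
      then have "f i z \<in> {v \<in> f i ` Z. b i < v}" using z by auto
      then have "\<gamma>0 i \<le> f i z" using finZ i unfolding \<gamma>0_def by (simp add: Min_le)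
      then show False using lt i by force
    qed
    then show "z \<in> S" using sol z by blast
  qed (use \<gamma>0 in auto)
  have ne: "\<Gamma> \<noteq> {}"
  proof -
    have "\<gamma>0 \<in> I \<rightarrow>\<^sub>E (\<Union>i\<in>I. f i ` Z)"
      by (rule PiE_I) (use \<gamma>0 in \<open>blast, simp add: \<gamma>0_def\<close>)
    then show ?thesis using \<open>valid \<gamma>0\<close> unfolding \<Gamma>_def by blast
  qed
  obtain \<gamma> where \<gamma>: "\<gamma> \<in> \<Gamma>" and mx: "\<And>\<delta>. \<delta> \<in> \<Gamma> \<Longrightarrow> (\<Sum>i\<in>I. \<delta> i) \<le> (\<Sum>i\<in>I. \<gamma> i)"
  proof -
    have "Max ((\<lambda>\<delta>. \<Sum>i\<in>I. \<delta> i) ` \<Gamma>) \<in> (\<lambda>\<delta>. \<Sum>i\<in>I. \<delta> i) ` \<Gamma>"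
      using fin\<Gamma> ne by (intro Max_in) auto
    then obtain \<gamma> where "\<gamma> \<in> \<Gamma>" "Max ((\<lambda>\<delta>. \<Sum>i\<in>I. \<delta> i) ` \<Gamma>) = (\<Sum>i\<in>I. \<gamma> i)" by auto
    then show ?thesis using that fin\<Gamma> by (metis Max_ge finite_imageI imageI)
  qed
  have val: "valid \<gamma>" and \<gamma>E: "\<gamma> \<in> I \<rightarrow>\<^sub>E (\<Union>i\<in>I. f i ` Z)" using \<gamma> by (auto simp: \<Gamma>_def)
  have ex: "\<exists>z\<in>Z - S. (\<forall>j\<in>I - {i}. f j z < \<gamma> j) \<and> f i z = \<gamma> i" if i: "i \<in> I" for i
  proof -
    \<comment> \<open>The least value of \<open>f i\<close> on \<open>Q\<close> is again a valid right-hand side, and at least \<open>\<gamma> i\<close>;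
      maximality of the sum forces equality.\<close>
    define Q where "Q = {z \<in> Z - S. \<forall>j\<in>I - {i}. f j z < \<gamma> j}"
    have finQ: "finite Q" using finZ by (auto simp: Q_def)
    obtain z0 where "z0 \<in> Z - S" "\<forall>j\<in>I - {i}. f j z0 \<le> b j" using crit[OF i] by blast
    then have "z0 \<in> Q" using val unfolding Q_def valid_def by force
    then have "Min (f i ` Q) \<in> f i ` Q" using finQ by (intro Min_in) auto
    then obtain z where z: "z \<in> Q" "Min (f i ` Q) = f i z" by auto
    have zmin: "f i z \<le> f i y" if "y \<in> Q" for y
      using that z(2) finQ by (metis Min_le finite_imageI imageI)
    have ge: "\<gamma> i \<le> f i z"
      using z(1) val unfolding Q_def valid_def by (force simp: not_less[symmetric])
    have "\<gamma>(i := f i z) \<in> \<Gamma>"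
      unfolding \<Gamma>_def mem_Collect_eq
    proof
      show "\<gamma>(i := f i z) \<in> I \<rightarrow>\<^sub>E (\<Union>i\<in>I. f i ` Z)"
        using \<gamma>E i z(1) by (auto simp: PiE_iff Q_def extensional_def)
      show "valid (\<gamma>(i := f i z))"
        unfolding valid_def
      proof (intro conjI ballI impI)
        fix j assume "j \<in> I"
        then show "b j < (\<gamma>(i := f i z)) j" using val ge unfolding valid_def by force
      next
        fix y assume y: "y \<in> Z" "\<forall>j\<in>I. f j y < (\<gamma>(i := f i z)) j"
        show "y \<in> S"
        proof (rule ccontr)
          assume "y \<notin> S"
          moreover have "f j y < \<gamma> j" if "j \<in> I - {i}" for j
            using y(2) that by (metis Diff_iff fun_upd_other insertI1)
          ultimately have "y \<in> Q" using y(1) by (simp add: Q_def)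
          then show False using zmin[of y] y(2) i by force
        qed
      qed
    qed
    from mx[OF this] have "f i z + (\<Sum>j\<in>I - {i}. \<gamma> j) \<le> \<gamma> i + (\<Sum>j\<in>I - {i}. \<gamma> j)"
      using finI i by (simp add: sum.remove[of I i])
    then show ?thesis using ge z(1) by (auto simp: Q_def)
  qed
  then obtain w where w: "\<And>i. i \<in> I \<Longrightarrow> w i \<in> Z - S \<and> (\<forall>j\<in>I - {i}. f j (w i) < \<gamma> j) \<and> f i (w i) = \<gamma> i"
    by metis
  show ?thesis
    by (rule that[of w]) (use w val in \<open>auto simp: valid_def\<close>)
qed

definition midpt :: "real vec \<Rightarrow> real vec \<Rightarrow> real vec" where
  "midpt x y = (1 / 2) \<cdot>\<^sub>v (x + y)"

lemma midpt_index:
  "x \<in> carrier_vec n \<Longrightarrow> y \<in> carrier_vec n \<Longrightarrow> i < n \<Longrightarrow> midpt x y $ i = (x $ i + y $ i) / 2"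
  by (simp add: midpt_def)

lemma finite_int_box:
  "finite {z \<in> carrier_vec n. \<forall>i<n. z $ i \<in> \<int> \<and> \<bar>z $ i :: real\<bar> \<le> of_int M}"
proof (rule finite_subset)
  show "{z \<in> carrier_vec n. \<forall>i<n. z $ i \<in> \<int> \<and> \<bar>z $ i :: real\<bar> \<le> of_int M}
      \<subseteq> vec n ` ({..<n} \<rightarrow>\<^sub>E of_int ` {-M..M})"
  proof safe
    fix z :: "real vec"
    assume z: "z \<in> carrier_vec n" and h: "\<forall>i<n. z $ i \<in> \<int> \<and> \<bar>z $ i\<bar> \<le> of_int M"
    have "z = vec n (restrict (($) z) {..<n})" using z by (intro eq_vecI) auto
    moreover have "z $ i \<in> of_int ` {-M..M}" if i: "i < n" for i
    proof -
      obtain u where "z $ i = of_int u" using h i Ints_cases by metis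
      moreover have "\<bar>real_of_int u\<bar> \<le> of_int M" using h i calculation by metis
      ultimately show ?thesis by (intro image_eqI[of _ _ u]) (simp_all add: abs_le_iff)
    qed
    ultimately show "z \<in> vec n ` ({..<n} \<rightarrow>\<^sub>E of_int ` {-M..M})"
      by (auto intro!: image_eqI[where x = "restrict (($) z) {..<n}"])
  qed
  show "finite (vec n ` ({..<n} \<rightarrow>\<^sub>E (of_int ` {-M..M} :: real set)))"
    by (intro finite_imageI finite_PiE) auto
qed

text \<open>
  A real linear form need not attain its infimum on a set of integer points, so the relaxation is
  carried out inside a box: it holds finitely many integer points and loses no integral midpoint.
\<close>

lemma finite_midpt_closed_superset:
  fixes W :: "real vec set"
  assumes "finite W" and W: "W \<subseteq> int_sols n {}"
  obtains Z where "finite Z" "W \<subseteq> Z" "Z \<subseteq> int_sols n {}"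
    and "\<And>x y. x \<in> Z \<Longrightarrow> y \<in> Z \<Longrightarrow> midpt x y \<in> int_sols n {} \<Longrightarrow> midpt x y \<in> Z"
proof -
  define B where "B = (\<Sum>w\<in>W. \<Sum>i<n. \<bar>w $ i\<bar>)"
  define K :: real where "K = of_int \<lceil>B\<rceil>"
  have bd: "\<bar>w $ i\<bar> \<le> K" if w: "w \<in> W" and i: "i < n" for w i
  proof -
    have "\<bar>w $ i\<bar> \<le> (\<Sum>i<n. \<bar>w $ i\<bar>)" using i by (intro member_le_sum) auto
    also have "\<dots> \<le> B" unfolding B_def using w assms(1)
      by (intro member_le_sum[of w W "\<lambda>w. \<Sum>i<n. \<bar>w $ i\<bar>"]) (auto intro: sum_nonneg)
    finally show ?thesis unfolding K_def by linarith
  qed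
  define Z where "Z = {z \<in> carrier_vec n. \<forall>i<n. z $ i \<in> \<int> \<and> \<bar>z $ i\<bar> \<le> K}"
  show ?thesis
  proof (rule that[of Z])
    show "finite Z" unfolding Z_def K_def by (rule finite_int_box)
    show "W \<subseteq> Z" using W bd by (auto simp: Z_def int_sols_def)
    show "Z \<subseteq> int_sols n {}" by (auto simp: Z_def int_sols_def)
    fix x y assume x: "x \<in> Z" and y: "y \<in> Z" and m: "midpt x y \<in> int_sols n {}"
    have "\<bar>midpt x y $ i\<bar> \<le> K" if i: "i < n" for i
    proof -
      have "\<bar>x $ i\<bar> \<le> K" "\<bar>y $ i\<bar> \<le> K" using x y i by (simp_all add: Z_def)
      moreover have "midpt x y $ i = (x $ i + y $ i) / 2"
        by (rule midpt_index[OF _ _ i]) (use x y in \<open>simp_all add: Z_def\<close>)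
      ultimately show ?thesis by (simp add: abs_le_iff)
    qed
    then show "midpt x y \<in> Z" using m by (simp add: Z_def int_sols_def)
  qed
qed

lemma scalar_prod_midpt:
  assumes "a \<in> carrier_vec n" "x \<in> carrier_vec n" "y \<in> carrier_vec n"
  shows "a \<bullet> midpt x y = (a \<bullet> x + a \<bullet> y) / 2"
proof -
  have "a \<bullet> midpt x y = (1 / 2) * (a \<bullet> (x + y))"
    unfolding midpt_def by (rule scalar_prod_smult_distrib[of _ n]) (use assms in simp_all)
  also have "a \<bullet> (x + y) = a \<bullet> x + a \<bullet> y"
    by (rule scalar_prod_add_distrib[of _ n]) (use assms in simp_all)
  finally show ?thesis by simp
qed

lemma midpt_left_cancel:
  assumes "x \<in> carrier_vec n" "y \<in> carrier_vec n" "z \<in> carrier_vec n" "midpt x y = midpt x z"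
  shows "y = z"
proof (rule eq_vecI)
  fix i assume "i < dim_vec z"
  then have i: "i < n" using assms(3) by simp
  have "midpt x y $ i = midpt x z $ i" using assms(4) by simp
  then show "y $ i = z $ i" using i assms(1-3) by (simp add: midpt_def)
qed (use assms in simp)

definition even_coords :: "nat \<Rightarrow> real vec \<Rightarrow> nat set" where
  "even_coords n x = {i. i < n \<and> even \<lfloor>x $ i\<rfloor>}"

lemma midpt_int:
  assumes x: "x \<in> int_sols n {}" and y: "y \<in> int_sols n {}" and par: "even_coords n x = even_coords n y"
  shows "midpt x y \<in> int_sols n {}"
proof -
  have carr: "x \<in> carrier_vec n" "y \<in> carrier_vec n" using x y by (simp_all add: int_sols_def)
  have "midpt x y $ i \<in> \<int>" if i: "i < n" for i
  proof -
    have "x $ i \<in> \<int>" "y $ i \<in> \<int>" using x y i by (simp_all add: int_sols_def)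
    then obtain a b where ab: "x $ i = of_int a" "y $ i = of_int b" by (auto elim!: Ints_cases)
    have "(i \<in> even_coords n x) = (i \<in> even_coords n y)" using par by simp
    then have "even a \<longleftrightarrow> even b" using i ab by (simp add: even_coords_def)
    then have "even (a + b)" by simp
    then obtain e where "a + b = 2 * e" by (rule evenE)
    then have "of_int a + of_int b = (2 * of_int e :: real)"
      by (metis of_int_add of_int_mult of_int_numeral)
    then have "midpt x y $ i = of_int e" using i ab carr by (simp add: midpt_def)
    then show ?thesis by simp
  qed
  then show ?thesis using carr by (simp add: int_sols_def midpt_def)
qed

text \<open>
  Within one of the \<open>2\<^sup>n\<close> parity classes, fix a point \<open>x\<close>. Its midpoints with the other points of
  the class are pairwise different elements of \<open>S\<close>.
\<close>

lemma card_le_if_same_parity_midpts_in: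
  assumes finW: "finite W" and W: "W \<subseteq> int_sols n {}" and finS: "finite S"
    and mid: "\<And>x y. x \<in> W \<Longrightarrow> y \<in> W \<Longrightarrow> x \<noteq> y \<Longrightarrow>
      even_coords n x = even_coords n y \<Longrightarrow> midpt x y \<in> S"
  shows "card W \<le> 2 ^ n * (card S + 1)"
proof -
  define T where "T P = {x \<in> W. even_coords n x = P}" for P
  have T: "card (T P) \<le> card S + 1" for P
  proof (cases "T P = {}")
    case False
    then obtain x where x: "x \<in> T P" by blast
    have finT: "finite (T P)" using finW by (simp add: T_def)
    have "inj_on (midpt x) (T P - {x})"
    proof (rule inj_onI)
      fix y z assume "y \<in> T P - {x}" "z \<in> T P - {x}" "midpt x y = midpt x z"
      then show "y = z"
        by (intro midpt_left_cancel[of x n y z]) (use x W in \<open>auto simp: T_def int_sols_def\<close>)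
    qed
    moreover have "midpt x ` (T P - {x}) \<subseteq> S"
      using mid x by (auto simp: T_def)
    ultimately have "card (T P - {x}) \<le> card S"
      using finS card_inj_on_le by blast
    then show ?thesis using finT x by (simp add: card_Diff_singleton)
  qed simp
  have "W = (\<Union>P\<in>Pow {..<n}. T P)" by (auto simp: T_def even_coords_def)
  then have "card W \<le> (\<Sum>P\<in>Pow {..<n}. card (T P))"
    by (metis card_UN_le finite_Pow_iff finite_lessThan)
  also have "\<dots> \<le> of_nat (card (Pow {..<n})) * (card S + 1)"
    by (rule sum_bounded_above) (rule T)
  finally show ?thesis by (simp add: card_Pow)
qed

text \<open>
  The parity bound applies to the tight witnesses of a smallest equivalent subsystem: for two of
  them, no linear form exceeds its tight value at either, and at most one of the two attains it,
  so their midpoint stays strictly below it.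
\<close>

lemma row_bound_exists: "row_bound n k (2 ^ n * (k + 1))"
  unfolding row_bound_iff
proof (intro allI impI, elim conjE)
  fix F assume finF: "finite F" and F: "fst ` F \<subseteq> carrier_vec n"
    and finS: "finite (int_sols n F)" and cardS: "card (int_sols n F) = k"
  obtain G where G: "G \<subseteq> F" "int_sols n G = int_sols n F"
    and least: "\<And>H. H \<subseteq> F \<Longrightarrow> int_sols n H = int_sols n F \<Longrightarrow> card G \<le> card H"
  proof -
    let ?P = "\<lambda>G. G \<subseteq> F \<and> int_sols n G = int_sols n F"
    have "?P F" by simp
    from ex_has_least_nat[of ?P, OF this, of card] obtain G
      where "?P G" "\<forall>H. ?P H \<longrightarrow> card G \<le> card H" by (elim exE conjE) blast
    then show ?thesis using that[of G] by simp
  qed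
  have finG: "finite G" using G(1) finF by (rule finite_subset)
  have "\<exists>z. z \<in> int_sols n (G - {q}) - int_sols n F" if q: "q \<in> G" for q
  proof (rule ccontr)
    assume "\<not> ?thesis"
    moreover have "int_sols n F \<subseteq> int_sols n (G - {q})"
      unfolding G(2)[symmetric] by (rule int_sols_antimono) blast
    ultimately have "int_sols n (G - {q}) = int_sols n F" by blast
    then have "card G \<le> card (G - {q})" by (intro least) (use G(1) in blast)
    moreover have "card (G - {q}) < card G" using card_Diff1_less[OF finG q] .
    ultimately show False by simp
  qed
  then obtain z where z: "\<And>q. q \<in> G \<Longrightarrow> z q \<in> int_sols n (G - {q}) - int_sols n F" by metis
  have zint: "z ` G \<subseteq> int_sols n {}"
    using z int_sols_antimono[of "{}" _ n] by blast
  obtain Z where finZ: "finite Z" and zZ: "z ` G \<subseteq> Z" and Zint: "Z \<subseteq> int_sols n {}"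
    and conv: "\<And>x y. x \<in> Z \<Longrightarrow> y \<in> Z \<Longrightarrow> midpt x y \<in> int_sols n {} \<Longrightarrow> midpt x y \<in> Z"
    using finite_midpt_closed_superset[OF finite_imageI[OF finG] zint] by metis
  have crit: "\<exists>z\<in>Z - int_sols n F. \<forall>q'\<in>G - {q}. fst q' \<bullet> z \<le> snd q'" if q: "q \<in> G" for q
    using z[OF q] zZ q by (intro bexI[of _ "z q"]) (auto simp: int_sols_def)
  have sol: "x \<in> int_sols n F" if "x \<in> Z" "\<forall>q\<in>G. fst q \<bullet> x \<le> snd q" for x
    using that Zint unfolding G(2)[symmetric] by (auto simp: int_sols_def)
  obtain w where wZ: "\<And>q. q \<in> G \<Longrightarrow> w q \<in> Z - int_sols n F"
    and wlt: "\<And>q q'. q \<in> G \<Longrightarrow> q' \<in> G \<Longrightarrow> q \<noteq> q' \<Longrightarrow> fst q' \<bullet> w q < fst q' \<bullet> w q'"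
    and win: "\<And>x. x \<in> Z \<Longrightarrow> (\<forall>q\<in>G. fst q \<bullet> x < fst q \<bullet> w q) \<Longrightarrow> x \<in> int_sols n F"
    by (rule tight_witnesses[OF finG finZ crit sol]) blast+
  have "inj_on w G"
  proof (rule inj_onI, rule ccontr)
    fix q q' assume "q \<in> G" "q' \<in> G" "w q = w q'" "q \<noteq> q'"
    then show False using wlt[of q q'] by simp
  qed
  then have "card G = card (w ` G)" by (simp add: card_image)
  also have "\<dots> \<le> 2 ^ n * (card (int_sols n F) + 1)"
  proof (rule card_le_if_same_parity_midpts_in)
    show "finite (w ` G)" using finG by simp
    show "w ` G \<subseteq> int_sols n {}" using wZ Zint by blast
    show "finite (int_sols n F)" by (rule finS)
    fix x y assume xy: "x \<in> w ` G" "y \<in> w ` G" "x \<noteq> y" "even_coords n x = even_coords n y"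
    then obtain q q' where q: "q \<in> G" "x = w q" "q' \<in> G" "y = w q'" "q \<noteq> q'" by blast
    have xZ: "x \<in> Z" and yZ: "y \<in> Z" using wZ q by blast+
    then have xs: "x \<in> int_sols n {}" and ys: "y \<in> int_sols n {}" using Zint by blast+
    show "midpt x y \<in> int_sols n F"
    proof (rule win)
      show "midpt x y \<in> Z" using conv[OF xZ yZ] midpt_int[OF xs ys xy(4)] by blast
      show "\<forall>p\<in>G. fst p \<bullet> midpt x y < fst p \<bullet> w p"
      proof
        fix p assume p: "p \<in> G"
        have le: "fst p \<bullet> w r \<le> fst p \<bullet> w p" "r \<noteq> p \<Longrightarrow> fst p \<bullet> w r < fst p \<bullet> w p"
          if "r \<in> G" for r
          using wlt[OF that p] by (cases "r = p"; simp)+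
        have "fst p \<bullet> x + fst p \<bullet> y < 2 * (fst p \<bullet> w p)"
          using le[OF q(1)] le[OF q(3)] q(2,4,5) by (cases "q = p") fastforce+
        moreover have "fst p \<in> carrier_vec n" using F G(1) p by blast
        ultimately show "fst p \<bullet> midpt x y < fst p \<bullet> w p"
          using xs ys by (subst scalar_prod_midpt[of _ n]) (simp_all add: int_sols_def)
      qed
    qed
  qed
  finally show "\<exists>G\<subseteq>F. card G \<le> 2 ^ n * (k + 1) \<and> int_sols n G = int_sols n F"
    using G cardS by auto
qed

lemma row_bound_c: "row_bound n k (c n k)"
  unfolding c_def using row_bound_exists by (rule LeastI)

section \<open>Systems cut out above a paraboloid\<close>

lemma infinite_nat_set_initial_segment:
  fixes A :: "nat set"
  assumes "infinite A"
  obtains t where "card {a \<in> A. a < t} = k" "k \<le> t"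
proof -
  let ?t = "enumerate A k"
  have "{a \<in> A. a < ?t} = enumerate A ` {..<k}"
    using enumerate_Ex[OF assms] enumerate_in_set[OF assms] assms by fastforce
  moreover have "inj_on (enumerate A) {..<k}"
    using strict_mono_enumerate[OF assms] by (simp add: strict_mono_imp_inj_on)
  ultimately have crd: "card {a \<in> A. a < ?t} = k" by (simp add: card_image)
  have "card {a \<in> A. a < ?t} \<le> card {..<?t}" by (intro card_mono) auto
  then show ?thesis using that crd by simp
qed

text \<open>
  The leading coefficient may exceed the base: it stands for the last coordinate of a point, which
  is unbounded.
\<close>

lemma digits_unique:
  fixes p q :: "nat \<Rightarrow> nat"
  assumes "\<And>i. i < d \<Longrightarrow> p i < B" "\<And>i. i < d \<Longrightarrow> q i < B"
    and "(\<Sum>i<Suc d. p i * B ^ i) = (\<Sum>i<Suc d. q i * B ^ i)" and "i \<le> d"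
  shows "p i = q i"
  using assms
proof (induction d arbitrary: p q i)
  case 0
  then show ?case by simp
next
  case (Suc d)
  have split: "(\<Sum>i<Suc (Suc d). r i * B ^ i) = r 0 + B * (\<Sum>i<Suc d. r (Suc i) * B ^ i)"
    for r :: "nat \<Rightarrow> nat"
    by (subst sum.lessThan_Suc_shift) (simp add: sum_distrib_left ac_simps del: sum.lessThan_Suc)
  have lt: "p 0 < B" "q 0 < B" using Suc.prems(1,2) by simp_all
  have eq: "p 0 + B * (\<Sum>i<Suc d. p (Suc i) * B ^ i) = q 0 + B * (\<Sum>i<Suc d. q (Suc i) * B ^ i)"
    using Suc.prems(3) unfolding split .
  from arg_cong[OF eq, of "\<lambda>m. m mod B"] have p0: "p 0 = q 0"
    using lt by (simp del: sum.lessThan_Suc)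
  then have tl: "(\<Sum>i<Suc d. p (Suc i) * B ^ i) = (\<Sum>i<Suc d. q (Suc i) * B ^ i)"
    using eq lt by (simp del: sum.lessThan_Suc)
  show ?case
  proof (cases i)
    case 0
    then show ?thesis using p0 by simp
  next
    case (Suc j)
    have "p (Suc j) = q (Suc j)"
      by (rule Suc.IH[of "\<lambda>i. p (Suc i)" "\<lambda>i. q (Suc i)"])
        (use Suc.prems(1,2,4) tl Suc in \<open>simp_all del: sum.lessThan_Suc\<close>)
    then show ?thesis using Suc by simp
  qed
qed

definition row_ineq :: "nat \<Rightarrow> (nat \<Rightarrow> real) \<Rightarrow> real \<Rightarrow> real vec \<times> real" where
  "row_ineq n a \<beta> = (vec n a, \<beta>)"

lemma row_ineq_sat:
  "x \<in> carrier_vec n \<Longrightarrow>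
    fst (row_ineq n a \<beta>) \<bullet> x \<le> snd (row_ineq n a \<beta>) \<longleftrightarrow> (\<Sum>i<n. a i * x $ i) \<le> \<beta>"
  by (simp add: row_ineq_def scalar_prod_def lessThan_atLeast0)

text \<open>
  The inequality \<open>2 u \<bullet> x - y \<le> |u|\<^sup>2 - 1\<close>: the half-space above the tangent plane of the
  paraboloid at \<open>(u, |u|\<^sup>2)\<close>, moved up by one.
\<close>

definition tang_row :: "nat \<Rightarrow> (nat \<Rightarrow> nat) \<Rightarrow> real vec \<times> real" where
  "tang_row d u = row_ineq (Suc d) (\<lambda>i. if i < d then 2 * real (u i) else -1)
     (real (\<Sum>i<d. (u i)\<^sup>2) - 1)"

definition box_rows :: "nat \<Rightarrow> nat \<Rightarrow> (real vec \<times> real) set" where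
  "box_rows d R =
     (\<lambda>i. row_ineq (Suc d) (\<lambda>j. if j = i then -1 else 0) 0) ` {..<d} \<union>
     (\<lambda>i. row_ineq (Suc d) (\<lambda>j. if j = i then 1 else 0) (real R)) ` {..<d}"

text \<open>
  For integral \<open>y\<close> and integral \<open>x\<close> with entries in \<open>{0..R}\<close>, this says that the number with digits \<open>x\<close> in base
  \<open>R + 1\<close> and leading part \<open>y\<close> is less than \<open>t\<close>.
\<close>

definition top_row :: "nat \<Rightarrow> nat \<Rightarrow> nat \<Rightarrow> real vec \<times> real" where
  "top_row d R t = row_ineq (Suc d) (\<lambda>i. real (Suc R) ^ i) (real t - 1)"

text \<open>The undefined values outside \<open>{..<d}\<close> put the grid points in bijection with the tangent rows.\<close>

definition grid :: "nat \<Rightarrow> nat \<Rightarrow> (nat \<Rightarrow> nat) set" where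
  "grid d R = {..<d} \<rightarrow>\<^sub>E {..R}"

definition paraboloid_system :: "nat \<Rightarrow> nat \<Rightarrow> nat \<Rightarrow> (real vec \<times> real) set" where
  "paraboloid_system d R t = insert (top_row d R t) (tang_row d ` grid d R \<union> box_rows d R)"

definition nat_vec :: "nat \<Rightarrow> (nat \<Rightarrow> nat) \<Rightarrow> real vec" where
  "nat_vec n p = vec n (\<lambda>i. real (p i))"

lemma tang_row_sat:
  "x \<in> carrier_vec (Suc d) \<Longrightarrow> fst (tang_row d u) \<bullet> x \<le> snd (tang_row d u) \<longleftrightarrow>
     (\<Sum>i<d. 2 * real (u i) * x $ i) + 1 \<le> x $ d + real (\<Sum>i<d. (u i)\<^sup>2)"
  unfolding tang_row_def by (subst row_ineq_sat) (auto simp: algebra_simps)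

lemma tang_row_sat_nat:
  "fst (tang_row d u) \<bullet> nat_vec (Suc d) p \<le> snd (tang_row d u) \<longleftrightarrow>
     (\<Sum>i<d. 2 * u i * p i) + 1 \<le> p d + (\<Sum>i<d. (u i)\<^sup>2)"
proof -
  have "(\<Sum>i<d. 2 * real (u i) * nat_vec (Suc d) p $ i) = real (\<Sum>i<d. 2 * u i * p i)"
    by (simp add: nat_vec_def)
  then have "fst (tang_row d u) \<bullet> nat_vec (Suc d) p \<le> snd (tang_row d u) \<longleftrightarrow>
     real (\<Sum>i<d. 2 * u i * p i) + 1 \<le> real (p d) + real (\<Sum>i<d. (u i)\<^sup>2)"
    by (subst tang_row_sat) (simp_all add: nat_vec_def)
  then show ?thesis by linarith
qed

lemma box_rows_sat:
  assumes "x \<in> carrier_vec (Suc d)"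
  shows "(\<forall>q\<in>box_rows d R. fst q \<bullet> x \<le> snd q) \<longleftrightarrow> (\<forall>i<d. 0 \<le> x $ i \<and> x $ i \<le> real R)"
proof -
  have "(\<Sum>j<Suc d. (if j = i then a else 0) * x $ j) = a * x $ i" if "i < d" for i and a :: real
    using that by (simp add: if_distrib[of "\<lambda>c. c * _"] sum.delta cong: if_cong del: sum.lessThan_Suc)
  then show ?thesis
    unfolding box_rows_def ball_Un ball_simps row_ineq_sat[OF assms]
    by (auto simp del: sum.lessThan_Suc)
qed

lemma top_row_sat_nat:
  "fst (top_row d R t) \<bullet> nat_vec (Suc d) p \<le> snd (top_row d R t) \<longleftrightarrow>
     (\<Sum>i<Suc d. p i * Suc R ^ i) < t"
proof -
  have "(\<Sum>i<Suc d. real (Suc R) ^ i * nat_vec (Suc d) p $ i) = real (\<Sum>i<Suc d. p i * Suc R ^ i)"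
    by (simp add: nat_vec_def mult.commute)
  then have "fst (top_row d R t) \<bullet> nat_vec (Suc d) p \<le> snd (top_row d R t) \<longleftrightarrow>
     real (\<Sum>i<Suc d. p i * Suc R ^ i) \<le> real t - 1"
    unfolding top_row_def
    by (subst row_ineq_sat) (simp_all add: nat_vec_def del: sum.lessThan_Suc)
  then show ?thesis by linarith
qed

lemma nat_vec_int: "nat_vec n p \<in> int_sols n {}"
  by (simp add: nat_vec_def int_sols_def)

text \<open>Both parts expand \<open>|u - p|\<^sup>2\<close>, which is at least 0, and at least 1 if \<open>u \<noteq> p\<close>.\<close>

lemma sum_two_mult_le:
  fixes u p :: "'i \<Rightarrow> nat"
  assumes "finite A"
  shows "(\<Sum>i\<in>A. 2 * u i * p i) \<le> (\<Sum>i\<in>A. (u i)\<^sup>2) + (\<Sum>i\<in>A. (p i)\<^sup>2)"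
    and "i \<in> A \<Longrightarrow> u i \<noteq> p i \<Longrightarrow>
      (\<Sum>i\<in>A. 2 * u i * p i) + 1 \<le> (\<Sum>i\<in>A. (u i)\<^sup>2) + (\<Sum>i\<in>A. (p i)\<^sup>2)"
proof -
  have le: "2 * u i * p i \<le> (u i)\<^sup>2 + (p i)\<^sup>2" for i
  proof -
    have "0 \<le> (int (u i) - int (p i))\<^sup>2" by simp
    then have "int (2 * u i * p i) \<le> int ((u i)\<^sup>2 + (p i)\<^sup>2)"
      by (simp add: power2_diff)
    then show ?thesis by linarith
  qed
  have lt: "2 * u i * p i < (u i)\<^sup>2 + (p i)\<^sup>2" if "u i \<noteq> p i" for i
  proof -
    have "0 < (int (u i) - int (p i))\<^sup>2" using that by simp
    then have "int (2 * u i * p i) < int ((u i)\<^sup>2 + (p i)\<^sup>2)"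
      by (simp add: power2_diff)
    then show ?thesis by linarith
  qed
  show "(\<Sum>i\<in>A. 2 * u i * p i) \<le> (\<Sum>i\<in>A. (u i)\<^sup>2) + (\<Sum>i\<in>A. (p i)\<^sup>2)"
    unfolding sum.distrib[symmetric] by (rule sum_mono) (rule le)
  assume "i \<in> A" "u i \<noteq> p i"
  then have "(\<Sum>i\<in>A. 2 * u i * p i) < (\<Sum>i\<in>A. (u i)\<^sup>2) + (\<Sum>i\<in>A. (p i)\<^sup>2)"
    unfolding sum.distrib[symmetric]
    by (intro sum_strict_mono_ex1) (use assms le lt in blast)+
  then show "(\<Sum>i\<in>A. 2 * u i * p i) + 1 \<le> (\<Sum>i\<in>A. (u i)\<^sup>2) + (\<Sum>i\<in>A. (p i)\<^sup>2)"
    by linarith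
qed

text \<open>The zeros beyond position \<open>d\<close> give each point a unique representing function.\<close>

definition above_paraboloid :: "nat \<Rightarrow> nat \<Rightarrow> (nat \<Rightarrow> nat) set" where
  "above_paraboloid d R = {p. (\<forall>i<d. p i \<le> R) \<and> (\<forall>i>d. p i = 0) \<and> (\<Sum>i<d. (p i)\<^sup>2) < p d}"

definition code :: "nat \<Rightarrow> nat \<Rightarrow> (nat \<Rightarrow> nat) \<Rightarrow> nat" where
  "code d R p = (\<Sum>i<Suc d. p i * Suc R ^ i)"

lemma inj_on_code: "inj_on (code d R) (above_paraboloid d R)"
proof (rule inj_onI, rule ext)
  fix p q i
  assume p: "p \<in> above_paraboloid d R" and q: "q \<in> above_paraboloid d R"
    and eq: "code d R p = code d R q"
  show "p i = q i"
  proof (cases "i \<le> d")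
    case True
    show ?thesis
      by (rule digits_unique[OF _ _ eq[unfolded code_def] True])
        (use p q in \<open>simp_all add: above_paraboloid_def less_Suc_eq_le\<close>)
  next
    case False
    then show ?thesis using p q by (simp add: above_paraboloid_def)
  qed
qed

lemma infinite_above_paraboloid: "infinite (above_paraboloid d R)"
proof -
  let ?f = "\<lambda>m i. if i = d then Suc m else 0 :: nat"
  have "inj ?f" by (rule injI) (metis nat.inject)
  moreover have "range ?f \<subseteq> above_paraboloid d R"
    by (auto simp: above_paraboloid_def)
  ultimately show ?thesis
    using finite_subset finite_imageD infinite_UNIV_nat by blast
qed

text \<open>
  A solution lies strictly above the paraboloid because of the tangent row at its own first \<open>d\<close>
  coordinates, which are a grid point by the box rows. Conversely, \<open>2 u \<bullet> x \<le> |u|\<^sup>2 + |x|\<^sup>2\<close> shows that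
  an integer point strictly above the paraboloid satisfies every tangent row.
\<close>

lemma int_sols_system:
  "int_sols (Suc d) (paraboloid_system d R t) = nat_vec (Suc d) ` {p \<in> above_paraboloid d R. code d R p < t}"
proof (intro equalityI subsetI)
  fix x assume x: "x \<in> int_sols (Suc d) (paraboloid_system d R t)"
  then have carr: "x \<in> carrier_vec (Suc d)" and int: "\<And>i. i \<le> d \<Longrightarrow> x $ i \<in> \<int>"
    and sat: "\<And>q. q \<in> paraboloid_system d R t \<Longrightarrow> fst q \<bullet> x \<le> snd q"
    by (auto simp: int_sols_def)
  have box: "0 \<le> x $ i" "x $ i \<le> real R" if "i < d" for i
    using sat box_rows_sat[OF carr, of R] that by (simp_all add: paraboloid_system_def)
  define p where "p i = (if i \<le> d then nat \<lfloor>x $ i\<rfloor> else 0)" for i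
  have pR: "p i \<le> R" and px: "real (p i) = x $ i" if i: "i < d" for i
  proof -
    obtain e where e: "x $ i = of_int e" using int[of i] i by (auto elim: Ints_cases)
    then show "p i \<le> R" "real (p i) = x $ i" using box[OF i] i by (simp_all add: p_def)
  qed
  let ?u = "restrict p {..<d}"
  have "?u \<in> grid d R" using pR by (auto simp: grid_def)
  then have "fst (tang_row d ?u) \<bullet> x \<le> snd (tang_row d ?u)"
    by (intro sat) (simp add: paraboloid_system_def)
  then have "(\<Sum>i<d. 2 * real (p i) * x $ i) + 1 \<le> x $ d + real (\<Sum>i<d. (p i)\<^sup>2)"
    unfolding tang_row_sat[OF carr] by simp
  moreover have "(\<Sum>i<d. 2 * real (p i) * x $ i) = 2 * real (\<Sum>i<d. (p i)\<^sup>2)"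
    using px by (simp add: sum_distrib_left power2_eq_square mult.assoc)
  ultimately have xd: "real (\<Sum>i<d. (p i)\<^sup>2) + 1 \<le> x $ d" by simp
  obtain e where e: "x $ d = of_int e" using int[of d] by (auto elim: Ints_cases)
  have "0 \<le> x $ d" using xd by (meson add_nonneg_nonneg of_nat_0_le_iff order_trans zero_le_one)
  then have pd: "real (p d) = x $ d" using e by (simp add: p_def)
  have x_eq: "x = nat_vec (Suc d) p"
    using carr px pd by (intro eq_vecI) (auto simp: nat_vec_def less_Suc_eq)
  have "(\<Sum>i<d. (p i)\<^sup>2) < p d" using xd pd by linarith
  then have "p \<in> above_paraboloid d R" using pR by (simp add: above_paraboloid_def p_def)
  moreover have "code d R p < t"
    using sat[of "top_row d R t"] unfolding x_eq top_row_sat_nat code_def by (simp add: paraboloid_system_def)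
  ultimately show "x \<in> nat_vec (Suc d) ` {p \<in> above_paraboloid d R. code d R p < t}"
    using x_eq by blast
next
  fix x assume "x \<in> nat_vec (Suc d) ` {p \<in> above_paraboloid d R. code d R p < t}"
  then obtain p where p: "p \<in> above_paraboloid d R" "code d R p < t" and x: "x = nat_vec (Suc d) p"
    by blast
  have pp: "(\<Sum>i<d. (p i)\<^sup>2) < p d" "\<And>i. i < d \<Longrightarrow> p i \<le> R"
    using p(1) by (simp_all add: above_paraboloid_def)
  have "x \<in> int_sols (Suc d) {}" using nat_vec_int x by simp
  then have carr: "x \<in> carrier_vec (Suc d)" and int: "\<forall>i<Suc d. x $ i \<in> \<int>"
    by (simp_all add: int_sols_def)
  have "fst (top_row d R t) \<bullet> x \<le> snd (top_row d R t)"
    using p(2) unfolding x top_row_sat_nat code_def .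
  moreover have "fst (tang_row d u) \<bullet> x \<le> snd (tang_row d u)" for u
    unfolding x tang_row_sat_nat using sum_two_mult_le(1)[of "{..<d}" u p] pp(1) by simp
  moreover have "\<forall>q\<in>box_rows d R. fst q \<bullet> x \<le> snd q"
    unfolding box_rows_sat[OF carr] using pp(2) by (simp add: x nat_vec_def)
  ultimately show "x \<in> int_sols (Suc d) (paraboloid_system d R t)"
    using carr int by (auto simp: int_sols_def paraboloid_system_def)
qed

text \<open>
  The codes are pairwise different natural numbers, so the solutions can be counted by their codes,
  and the count takes every value as \<open>t\<close> grows. Since \<open>k\<close> different codes lie below \<open>t\<close>, also \<open>k \<le> t\<close>.
\<close>

lemma card_int_sols_system:
  obtains t where "k \<le> t" "finite (int_sols (Suc d) (paraboloid_system d R t))" "card (int_sols (Suc d) (paraboloid_system d R t)) = k"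
proof -
  let ?K = "above_paraboloid d R"
  have "infinite (code d R ` ?K)"
    using inj_on_code infinite_above_paraboloid finite_imageD by blast
  then obtain t where t: "card {a \<in> code d R ` ?K. a < t} = k" "k \<le> t"
    by (rule infinite_nat_set_initial_segment)
  let ?L = "{p \<in> ?K. code d R p < t}"
  have inj: "inj_on (code d R) ?L" by (rule inj_on_subset[OF inj_on_code]) blast
  have img: "code d R ` ?L = {a \<in> code d R ` ?K. a < t}" by blast
  have "finite (code d R ` ?L)" unfolding img by simp
  then have fin: "finite ?L" using inj by (rule finite_imageD)
  have "card ?L = k" using card_image[OF inj] t(1) unfolding img by simp
  moreover have "inj_on (nat_vec (Suc d)) ?L"
  proof (rule inj_onI, rule ext)
    fix p q i assume pq: "p \<in> ?L" "q \<in> ?L" and eq: "nat_vec (Suc d) p = nat_vec (Suc d) q"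
    show "p i = q i"
    proof (cases "i \<le> d")
      case True
      then show ?thesis using arg_cong[OF eq, of "\<lambda>v. v $ i"] by (simp add: nat_vec_def)
    next
      case False
      then show ?thesis using pq by (simp add: above_paraboloid_def)
    qed
  qed
  ultimately have "card (int_sols (Suc d) (paraboloid_system d R t)) = k"
    unfolding int_sols_system by (simp add: card_image)
  then show ?thesis using that t(2) fin unfolding int_sols_system by blast
qed

section \<open>The lower bound\<close>

text \<open>
  The point \<open>(u, |u|\<^sup>2)\<close> violates its own tangent row and no other row. The condition on \<open>t\<close> is what
  the top row needs: the code of the point is at most
  \<open>d R (R + 1)\<^sup>d + d R\<^sup>2 (R + 1)\<^sup>d = d R (R + 1)\<^sup>d\<^sup>+\<^sup>1\<close>.
\<close>

lemma tang_row_critical: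
  assumes u: "u \<in> grid d R" and t: "d * R * Suc R ^ Suc d < t"
  shows "\<exists>x \<in> int_sols (Suc d) (paraboloid_system d R t - {tang_row d u}). x \<notin> int_sols (Suc d) (paraboloid_system d R t)"
proof -
  define p where "p i = (if i < d then u i else \<Sum>i<d. (u i)\<^sup>2)" for i
  let ?x = "nat_vec (Suc d) p"
  have uR: "u i \<le> R" if "i < d" for i using u that by (auto simp: grid_def)
  have sq: "(\<Sum>i<d. (p i)\<^sup>2) = (\<Sum>i<d. (u i)\<^sup>2)" and pd: "p d = (\<Sum>i<d. (u i)\<^sup>2)"
    by (simp_all add: p_def)
  have x: "?x \<in> carrier_vec (Suc d)" "\<forall>i<Suc d. ?x $ i \<in> \<int>"
    using nat_vec_int[of "Suc d" p] by (simp_all add: int_sols_def)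
  have "\<not> fst (tang_row d u) \<bullet> ?x \<le> snd (tang_row d u)"
  proof -
    have "(\<Sum>i<d. 2 * u i * p i) = (\<Sum>i<d. (u i)\<^sup>2) + (\<Sum>i<d. (u i)\<^sup>2)"
      unfolding sum.distrib[symmetric] by (rule sum.cong) (simp_all add: p_def power2_eq_square)
    then show ?thesis unfolding tang_row_sat_nat pd by simp
  qed
  then have "?x \<notin> int_sols (Suc d) (paraboloid_system d R t)"
    using u by (auto simp: int_sols_def paraboloid_system_def)
  moreover have "?x \<in> int_sols (Suc d) (paraboloid_system d R t - {tang_row d u})"
  proof -
    have top: "fst (top_row d R t) \<bullet> ?x \<le> snd (top_row d R t)"
    proof -
      have "(\<Sum>i<d. p i * Suc R ^ i) \<le> of_nat (card {..<d}) * (R * Suc R ^ d)"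
        by (rule sum_bounded_above)
          (use uR in \<open>auto simp: p_def intro!: mult_mono power_increasing\<close>)
      moreover have "p d \<le> of_nat (card {..<d}) * R\<^sup>2"
        unfolding pd by (rule sum_bounded_above) (use uR in \<open>auto intro: power_mono\<close>)
      then have "p d * Suc R ^ d \<le> of_nat (card {..<d}) * R\<^sup>2 * Suc R ^ d"
        by (rule mult_le_mono1)
      ultimately have "(\<Sum>i<Suc d. p i * Suc R ^ i) \<le> d * (R * Suc R ^ d) + d * R\<^sup>2 * Suc R ^ d"
        unfolding sum.lessThan_Suc card_lessThan of_nat_id by (rule add_mono)
      also have "\<dots> = d * R * Suc R ^ Suc d" by (simp add: power2_eq_square algebra_simps)
      finally show ?thesis unfolding top_row_sat_nat using t by simp
    qed
    have tang: "fst (tang_row d v) \<bullet> ?x \<le> snd (tang_row d v)" if v: "v \<in> grid d R" "v \<noteq> u" for v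
    proof -
      obtain i where i: "i < d" "v i \<noteq> u i"
        using v u PiE_ext[of v "{..<d}" "\<lambda>_. {..R}" u] unfolding grid_def by blast
      then have "v i \<noteq> p i" by (simp add: p_def)
      then show ?thesis
        unfolding tang_row_sat_nat
        using sum_two_mult_le(2)[of "{..<d}" i v p] i(1) unfolding sq pd by simp
    qed
    have box: "\<forall>q\<in>box_rows d R. fst q \<bullet> ?x \<le> snd q"
      unfolding box_rows_sat[OF x(1)] using uR by (simp add: nat_vec_def p_def)
    have "fst q \<bullet> ?x \<le> snd q" if "q \<in> paraboloid_system d R t - {tang_row d u}" for q
    proof -
      from that consider "q = top_row d R t" | v where "v \<in> grid d R" "v \<noteq> u" "q = tang_row d v"
        | "q \<in> box_rows d R"
        unfolding paraboloid_system_def by blast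
      then show ?thesis using top tang box by cases auto
    qed
    then show ?thesis using x by (simp add: int_sols_def)
  qed
  ultimately show ?thesis by blast
qed

lemma card_grid: "card (grid d R) = Suc R ^ d"
  by (simp add: grid_def card_PiE)

lemma inj_on_tang_row: "inj_on (tang_row d) (grid d R)"
proof (rule inj_onI)
  fix u v assume uv: "u \<in> grid d R" "v \<in> grid d R" and eq: "tang_row d u = tang_row d v"
  show "u = v"
  proof (rule PiE_ext[OF uv[unfolded grid_def]])
    fix i assume "i \<in> {..<d}"
    then show "u i = v i"
      using arg_cong[OF eq, of "\<lambda>q. fst q $ i"] by (simp add: tang_row_def row_ineq_def)
  qed
qed

lemma row_bound_ge:
  assumes N: "row_bound (Suc d) k N" and k: "d * R * Suc R ^ Suc d < k"
  shows "Suc R ^ d \<le> N"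
proof -
  obtain t where t: "k \<le> t" and fin: "finite (int_sols (Suc d) (paraboloid_system d R t))"
    and crd: "card (int_sols (Suc d) (paraboloid_system d R t)) = k"
    by (rule card_int_sols_system)
  have finF: "finite (paraboloid_system d R t)"
    by (simp add: paraboloid_system_def box_rows_def grid_def finite_PiE)
  have "fst ` paraboloid_system d R t \<subseteq> carrier_vec (Suc d)"
    by (auto simp: paraboloid_system_def box_rows_def tang_row_def top_row_def row_ineq_def)
  then obtain G where G: "G \<subseteq> paraboloid_system d R t" "card G \<le> N"
    "int_sols (Suc d) G = int_sols (Suc d) (paraboloid_system d R t)"
    using N[unfolded row_bound_iff] finF fin crd by blast
  have "tang_row d ` grid d R \<subseteq> G"
  proof (rule ccontr)
    assume "\<not> ?thesis"
    then obtain u where u: "u \<in> grid d R" "tang_row d u \<notin> G" by blast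
    then have "int_sols (Suc d) (paraboloid_system d R t - {tang_row d u}) \<subseteq> int_sols (Suc d) G"
      using G(1) by (intro int_sols_antimono) blast
    then show False using tang_row_critical[OF u(1), of t] k t G(3) by auto
  qed
  then have "card (tang_row d ` grid d R) \<le> card G"
    using finite_subset[OF G(1) finF] by (intro card_mono)
  then show ?thesis using G(2) by (simp add: card_image[OF inj_on_tang_row] card_grid)
qed

text \<open>
  The constant is \<open>M\<close> to the power \<open>- d / (d + 2)\<close> with \<open>M = d 2\<^sup>d\<^sup>+\<^sup>1\<close>. The factor \<open>2\<^sup>d\<^sup>+\<^sup>1\<close> comes from
  \<open>R + 1 \<le> 2 R\<close>, which replaces the requirement on \<open>R\<close> by the simpler \<open>M R\<^sup>d\<^sup>+\<^sup>2 < k\<close>; the case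
  \<open>R = 0\<close> only needs \<open>k > 0\<close>.
\<close>

theorem theorem4p7:
  shows "\<forall>n::nat. n \<ge> 2 \<longrightarrow>
    (\<exists>C::real. C > 0 \<and>
      (\<forall>k::nat. real (c n k) \<ge> C * real k powr ((real n - 1) / (real n + 1))))"
proof (intro allI impI)
  fix n :: nat assume "n \<ge> 2"
  then obtain d where n: "n = Suc d" and d: "d \<ge> 1" by (cases n) auto
  define M where "M = real d * 2 ^ Suc d"
  have M: "M > 0" using d by (simp add: M_def)
  define \<alpha> where "\<alpha> = (real n - 1) / (real n + 1)"
  have \<alpha>: "\<alpha> = real d / (real d + 2)" by (simp add: \<alpha>_def n)
  show "\<exists>C::real. C > 0 \<and>
      (\<forall>k::nat. real (c n k) \<ge> C * real k powr ((real n - 1) / (real n + 1)))"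
  proof (intro exI[of _ "(1 / M) powr \<alpha>"] conjI allI)
    show "(1 / M) powr \<alpha> > 0" using M by simp
    fix k :: nat
    show "real (c n k) \<ge> (1 / M) powr \<alpha> * real k powr ((real n - 1) / (real n + 1))"
    proof (cases "k = 0")
      case True
      then show ?thesis by simp
    next
      case False
      define \<rho> where "\<rho> = (real k / M) powr (1 / (real d + 2))"
      have \<rho>: "\<rho> > 0" using False M by (simp add: \<rho>_def)
      \<comment> \<open>The largest integer strictly below \<open>\<rho>\<close>.\<close>
      define R where "R = nat (\<lceil>\<rho>\<rceil> - 1)"
      have "\<lceil>\<rho>\<rceil> \<ge> 1" using \<rho> by linarith
      then have R: "real R < \<rho>" "\<rho> \<le> real (Suc R)" unfolding R_def by linarith+
      have "\<rho> ^ (d + 2) = \<rho> powr real (d + 2)" using \<rho> by (simp only: powr_realpow)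
      also have "\<dots> = (real k / M) powr (real (d + 2) / (real d + 2))"
        by (simp add: \<rho>_def powr_powr)
      also have "real (d + 2) / (real d + 2) = 1" by simp
      also have "(real k / M) powr 1 = real k / M" using M by simp
      finally have \<rho>k: "\<rho> ^ (d + 2) = real k / M" .
      have "d * R * Suc R ^ Suc d < k"
      proof (cases "R = 0")
        case False
        have "real (d * R * Suc R ^ Suc d) \<le> real d * real R * (2 * real R) ^ Suc d"
          unfolding of_nat_mult of_nat_power
          by (intro mult_left_mono power_mono) (use False in auto)
        also have "\<dots> = M * real R ^ (d + 2)"
          by (simp add: M_def power_mult_distrib)
        also have "\<dots> < M * \<rho> ^ (d + 2)"
          using M R(1) by (intro mult_strict_left_mono power_strict_mono) auto
        also have "\<dots> = real k" unfolding \<rho>k using M by simp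
        finally show ?thesis by linarith
      qed (use \<open>k \<noteq> 0\<close> in simp)
      then have ge: "Suc R ^ d \<le> c n k"
        using row_bound_ge[OF row_bound_c[of n k, unfolded n]] n by simp
      have "(1 / M) powr \<alpha> * real k powr \<alpha> = (real k / M) powr \<alpha>"
        using M by (simp add: powr_mult[symmetric])
      also have "\<dots> = \<rho> powr real d" by (simp add: \<rho>_def powr_powr \<alpha>)
      also have "\<dots> = \<rho> ^ d" using \<rho> by (simp only: powr_realpow)
      also have "\<dots> \<le> real (Suc R) ^ d" using R(2) \<rho> by (intro power_mono) auto
      also have "\<dots> = real (Suc R ^ d)" by simp
      also have "\<dots> \<le> real (c n k)" using ge by (simp only: of_nat_le_iff)
      finally show ?thesis by (simp only: \<alpha>_def)
    qed
  qed
qed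

end
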